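(* For $\sigma\in0\{0,1\}^{n-1}$, $$F(R_\sigma,\mathbf{x})=F(Q_\sigma,\mathbf{x})+\sum_{\tau<_{lex}\sigma}c_\tau F(Q_\tau,\mathbf{x})$$ for some nonnegative integers $c_\tau$, with $\tau$ ranging over $0\{0,1\}^{n-1}$.
   Context: A labelled poset on $[n]$ is a partial order $<_P$ on the set $[n]$. A $P$-partition is $f:[n]\to\mathbb{P}=\{1,2,\ldots\}$ with $f(i)\le f(i')$ whenever $i\le_Pi'$ and $f(i)<f(i')$ whenever $i\le_Pi'$ and $i>i'$ as integers; $F(P,\mathbf{x})=\sum_f\prod_ix_{f(i)}$ over all $P$-partitions. For labelled posets $P_1,P_2$ on disjoint label sets, $P_1\oplus P_2$ is their disjoint union with the additional relations $p_1<p_2$ for all $p_1\in P_1,p_2\in P_2$. $0\{0,1\}^{n-1}$ is the set of binary strings $\sigma=\sigma_1\cdots\sigma_n$ with $\sigma_1=0$, ordered lexicographically with $0<1$. $R_\sigma$ is the labelled poset on $[n]$ with $i<_{R_\sigma}j$ if and only if $\sigma_i=0$, $\sigma_j=1$ and $i<j$. The labelled posets $Q_\sigma$ on $[k]$ (for strings $\sigma$ of length $k$ beginning with $0$) are defined recursively: if $\sigma$ consists of $k$ zeroes, $Q_\sigma$ is the antichain on $[k]$; if $\sigma=\hat\sigma1$ with $\hat\sigma$ of length $k-1$, then $Q_\sigma=Q_{\hat\sigma}\oplus(k)$ with $(k)$ the one-element poset labelled $k$; if $\sigma=\hat\sigma0$ is not all zeroes, $Q_\sigma$ is obtained from $Q_{\hat\sigma}$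 by adding a new element labelled $k$ with the single new relation $k-1<k$ (plus those implied by transitivity), then swapping the labels $k-1$ and $k$. *)

theory Defs
  imports "HOL-Library.Multiset" "HOL-Library.FuncSet" "HOL-Combinatorics.Transposition"
begin

text \<open>
  A labelled poset is given by its label set together with its strict order relation
  \<open><\<^sub>P\<close>, so that \<open>\<le>\<^sub>P\<close> is the reflexive closure.
\<close>

type_synonym lposet = "nat set \<times> (nat \<times> nat) set"

definition labelled_poset :: "nat set \<Rightarrow> lposet \<Rightarrow> bool" where
  "labelled_poset A P \<longleftrightarrow> fst P = A \<and> snd P \<subseteq> A \<times> A \<and> irrefl (snd P) \<and> trans (snd P)"

definition P_partitions :: "lposet \<Rightarrow> (nat \<Rightarrow> nat) set" where
  "P_partitions P = {f \<in> fst P \<rightarrow>\<^sub>E {1..}.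
     (\<forall>i\<in>fst P. \<forall>i'\<in>fst P. (i, i') \<in> (snd P)\<^sup>= \<longrightarrow> f i \<le> f i') \<and>
     (\<forall>i\<in>fst P. \<forall>i'\<in>fst P. (i, i') \<in> (snd P)\<^sup>= \<and> i > i' \<longrightarrow> f i < f i')}"

text \<open>
  A formal power series in \<open>x\<^sub>1, x\<^sub>2, \<dots>\<close> over the integers is represented by its coefficient
  function. A monomial is the multiset of the indices of its variables, so the product of the
  \<open>x\<^bsub>f(i)\<^esub>\<close> is the image of the label set under \<open>f\<close>, with multiplicities.
\<close>

definition P_gf :: "lposet \<Rightarrow> nat multiset \<Rightarrow> int" where
  "P_gf P m = int (card {f \<in> P_partitions P. image_mset f (mset_set (fst P)) = m})"

lemma finite_P_partitions_with_content:
  assumes "finite (fst P)"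
  shows "finite {f \<in> P_partitions P. image_mset f (mset_set (fst P)) = m}"
proof (rule finite_subset)
  show "{f \<in> P_partitions P. image_mset f (mset_set (fst P)) = m} \<subseteq> fst P \<rightarrow>\<^sub>E set_mset m"
    using assms by (auto simp: P_partitions_def PiE_iff extensional_def)
  show "finite (fst P \<rightarrow>\<^sub>E set_mset m)"
    using assms by (intro finite_PiE) auto
qed

definition ordinal_sum :: "lposet \<Rightarrow> lposet \<Rightarrow> lposet" where
  "ordinal_sum P1 P2 = (fst P1 \<union> fst P2, snd P1 \<union> snd P2 \<union> fst P1 \<times> fst P2)"

definition antichain_poset :: "nat set \<Rightarrow> lposet" where
  "antichain_poset A = (A, {})"

definition add_above :: "nat \<Rightarrow> nat \<Rightarrow> lposet \<Rightarrow> lposet" where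
  "add_above a b P = (insert b (fst P), (insert (a, b) (snd P))\<^sup>+)"

definition relabel :: "(nat \<Rightarrow> nat) \<Rightarrow> lposet \<Rightarrow> lposet" where
  "relabel g P = (g ` fst P, map_prod g g ` snd P)"

text \<open>
  Binary strings are lists of Booleans, with \<open>False\<close> for 0 and \<open>True\<close> for 1; the letter
  \<open>\<sigma>\<^sub>i\<close> is \<open>\<sigma> ! (i - 1)\<close>.
\<close>

definition zero_strings :: "nat \<Rightarrow> bool list set" where
  "zero_strings n = {\<sigma>. length \<sigma> = n \<and> \<sigma> \<noteq> [] \<and> hd \<sigma> = False}"

definition lex_less :: "bool list \<Rightarrow> bool list \<Rightarrow> bool" where
  "lex_less \<tau> \<sigma> \<longleftrightarrow> (\<tau>, \<sigma>) \<in> lexord {(False, True)}"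

definition R_poset :: "bool list \<Rightarrow> lposet" where
  "R_poset \<sigma> = ({1..length \<sigma>},
     {(i, j). i \<in> {1..length \<sigma>} \<and> j \<in> {1..length \<sigma>} \<and>
        \<sigma> ! (i - 1) = False \<and> \<sigma> ! (j - 1) = True \<and> i < j})"

function Q_poset :: "bool list \<Rightarrow> lposet" where
  "Q_poset \<sigma> =
     (let k = length \<sigma>; \<sigma>' = butlast \<sigma> in
      if \<forall>b\<in>set \<sigma>. b = False then antichain_poset {1..k}
      else if last \<sigma> = True then ordinal_sum (Q_poset \<sigma>') (antichain_poset {k})
      else relabel (transpose (k - 1) k) (add_above (k - 1) k (Q_poset \<sigma>')))"
  by pat_completeness auto
termination
  by (relation "measure length") (auto dest: length_pos_if_in_set)

declare Q_poset.simps [simp del]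

lemma Q_poset_zeroes: "Q_poset (replicate k False) = antichain_poset {1..k}"
  by (subst Q_poset.simps) (simp add: Let_def)

lemma Q_poset_snoc_True:
  "Q_poset (\<sigma> @ [True]) = ordinal_sum (Q_poset \<sigma>) (antichain_poset {Suc (length \<sigma>)})"
  by (subst Q_poset.simps) (simp add: Let_def)

lemma Q_poset_snoc_False:
  assumes "True \<in> set \<sigma>"
  shows "Q_poset (\<sigma> @ [False]) =
    relabel (transpose (length \<sigma>) (Suc (length \<sigma>)))
      (add_above (length \<sigma>) (Suc (length \<sigma>)) (Q_poset \<sigma>))"
  using assms by (subst Q_poset.simps) (auto simp: Let_def)

lemma labelled_poset_R: "labelled_poset {1..length \<sigma>} (R_poset \<sigma>)"
  by (auto simp: labelled_poset_def R_poset_def irrefl_def trans_def)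

lemma labelled_poset_ordinal_sum:
  assumes "labelled_poset A P1" "labelled_poset B P2" "A \<inter> B = {}"
  shows "labelled_poset (A \<union> B) (ordinal_sum P1 P2)"
  using assms unfolding labelled_poset_def ordinal_sum_def irrefl_def trans_def
  by (simp, blast)

lemma labelled_poset_add_above:
  assumes "labelled_poset A P" "a \<in> A" "b \<notin> A"
  shows "labelled_poset (insert b A) (add_above a b P)"
proof -
  have P: "fst P = A" "snd P \<subseteq> A \<times> A" "irrefl (snd P)" "trans (snd P)"
    using assms(1) by (auto simp: labelled_poset_def)
  have "(insert (a, b) (snd P))\<^sup>+ = snd P \<union> {(x, b) | x. (x, a) \<in> (snd P)\<^sup>=}"
  proof (intro equalityI subrelI)
    fix x y assume "(x, y) \<in> (insert (a, b) (snd P))\<^sup>+"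
    then show "(x, y) \<in> snd P \<union> {(x, b) | x. (x, a) \<in> (snd P)\<^sup>=}"
    proof (induction rule: trancl_induct)
      case (base y)
      then show ?case by auto
    next
      case (step y z)
      then show ?case using P assms(2,3) by (auto dest: transD)
    qed
  next
    fix x y assume "(x, y) \<in> snd P \<union> {(x, b) | x. (x, a) \<in> (snd P)\<^sup>=}"
    then show "(x, y) \<in> (insert (a, b) (snd P))\<^sup>+"
      by (auto intro: trancl_into_trancl)
  qed
  then have "(insert (a, b) (snd P))\<^sup>+ \<subseteq> insert b A \<times> insert b A"
    and "irrefl ((insert (a, b) (snd P))\<^sup>+)"
    using P assms(2,3) by (auto simp: irrefl_def)
  then show ?thesis
    using P by (simp add: labelled_poset_def add_above_def)
qed

lemma labelled_poset_relabel:
  assumes "labelled_poset A P" "inj g"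
  shows "labelled_poset (g ` A) (relabel g P)"
  using assms unfolding labelled_poset_def relabel_def irrefl_def trans_def
  by (fastforce dest: injD)

lemma labelled_poset_Q: "labelled_poset {1..length \<sigma>} (Q_poset \<sigma>)"
proof (induction \<sigma> rule: rev_induct)
  case Nil
  show ?case using Q_poset_zeroes[of 0]
    by (simp add: labelled_poset_def antichain_poset_def irrefl_def)
next
  case (snoc b \<sigma>)
  let ?k = "Suc (length \<sigma>)"
  have A: "labelled_poset B (antichain_poset B)" for B
    by (simp add: labelled_poset_def antichain_poset_def irrefl_def)
  have ins: "{1..length \<sigma>} \<union> {?k} = {1..?k}" by auto
  show ?case
  proof (cases b)
    case True
    then show ?thesis
      using labelled_poset_ordinal_sum[OF snoc A[of "{?k}"]] ins
      by (simp add: Q_poset_snoc_True)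
  next
    case False
    show ?thesis
    proof (cases "True \<in> set \<sigma>")
      case True
      then have "\<sigma> \<noteq> []" by auto
      then have k: "length \<sigma> \<in> {1..length \<sigma>}" by (simp add: Suc_le_eq)
      have "labelled_poset (insert ?k {1..length \<sigma>}) (add_above (length \<sigma>) ?k (Q_poset \<sigma>))"
        by (rule labelled_poset_add_above[OF snoc k]) simp
      from labelled_poset_relabel[OF this inj_on_transpose, of "length \<sigma>" ?k]
      have "labelled_poset (transpose (length \<sigma>) ?k ` insert ?k {1..length \<sigma>})
        (Q_poset (\<sigma> @ [False]))"
        by (simp only: Q_poset_snoc_False[OF True])
      moreover have "transpose (length \<sigma>) ?k ` insert ?k {1..length \<sigma>} = insert ?k {1..length \<sigma>}"
        using k by (intro transpose_image_eq) auto
      ultimately show ?thesis using False ins by simp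
    next
      case F: False
      have "y = False" if "y \<in> set (\<sigma> @ [b])" for y
        using F False that by (cases y) auto
      then have "\<sigma> @ [b] = replicate ?k False"
        by (intro replicate_eqI) simp_all
      then show ?thesis using A by (simp only: Q_poset_zeroes length_replicate)
    qed
  qed
qed

end

theory Submission
  imports Defs
begin

text \<open>
  The \<open>P\<close>-partitions of \<open>Q\<^sub>\<tau>\<close> with \<open>\<tau> = \<rho>10\<^sup>s\<close> are those of \<open>Q\<^sub>\<rho>\<close>
  together with one value \<open>x\<close> weakly above all of them and \<open>s\<close> arbitrary values strictly
  above \<open>x\<close>. Write \<open>\<sigma> = \<rho>10\<^sup>b\<close> and let \<open>u\<close> be the element of the last one of
  \<open>\<sigma>\<close>. Sorting the \<open>P\<close>-partitions \<open>f\<close> of \<open>R\<^sub>\<sigma>\<close> by the set \<open>S\<close> of elements with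
  \<open>f\<close>-value above \<open>f u\<close> expresses \<open>F(R\<^sub>\<sigma>)\<close> as a sum over \<open>S\<close> of the same construction
  applied to \<open>F(R\<^sub>\<sigma>\<^sub>')\<close>, where \<open>\<sigma>'\<close> arises from \<open>\<sigma>\<close> by deleting \<open>u\<close> and \<open>S\<close>. By induction
  on the length, \<open>F(R\<^sub>\<sigma>\<^sub>')\<close> has leading term \<open>F(Q\<^sub>\<sigma>\<^sub>')\<close>, and the string \<open>\<sigma>'10\<^bsup>|S|\<^esup>\<close> is
  lexicographically below \<open>\<sigma>\<close> unless \<open>S\<close> consists of the trailing zeroes, where it equals \<open>\<sigma>\<close>.
\<close>

section \<open>Generating functions of constrained maps and the stacking operator\<close>

text \<open>Label set and condition are arbitrary, so elements can be deleted without renumbering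
  the remaining labels.\<close>

definition gf :: "nat set \<Rightarrow> ((nat \<Rightarrow> nat) \<Rightarrow> bool) \<Rightarrow> nat multiset \<Rightarrow> int" where
  "gf A C m = int (card {f \<in> A \<rightarrow>\<^sub>E {1..}. C f \<and> image_mset f (mset_set A) = m})"

text \<open>The pair \<open>(x, l)\<close> stands for an element of value \<open>x\<close> weakly above all that
  \<open>stack_gf\<close> is applied to, and \<open>s\<close> elements strictly above it, with values \<open>l\<close>.\<close>

definition stack_splits :: "nat \<Rightarrow> nat multiset \<Rightarrow> (nat \<times> nat list) set" where
  "stack_splits s m = {(x, l). 1 \<le> x \<and> length l = s \<and> add_mset x (mset l) \<subseteq># m \<and>
     (\<forall>y\<in>#m - add_mset x (mset l). y \<le> x) \<and> (\<forall>y\<in>set l. x < y)}"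

text \<open>An operator on power series rather than on posets: being linear, it can be applied to
  the difference of F(R) and F(Q).\<close>

definition stack_gf :: "nat \<Rightarrow> (nat multiset \<Rightarrow> int) \<Rightarrow> nat multiset \<Rightarrow> int" where
  "stack_gf s G m = (\<Sum>(x, l)\<in>stack_splits s m. G (m - add_mset x (mset l)))"

lemma finite_stack_splits: "finite (stack_splits s m)"
proof (rule finite_subset)
  show "stack_splits s m \<subseteq> set_mset m \<times> {l. set l \<subseteq> set_mset m \<and> length l = s}"
    by (auto simp: stack_splits_def dest: mset_subset_eqD)
  show "finite (set_mset m \<times> {l. set l \<subseteq> set_mset m \<and> length l = s})"
    by (intro finite_cartesian_product finite_lists_length_eq) auto
qed

lemma stack_gf_zero: "stack_gf s (\<lambda>m. 0) = (\<lambda>m. 0)"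
  by (auto simp: stack_gf_def)

lemma stack_gf_add: "stack_gf s (\<lambda>m. G m + H m) = (\<lambda>m. stack_gf s G m + stack_gf s H m)"
  by (simp add: stack_gf_def sum.distrib case_prod_beta fun_eq_iff)

lemma stack_gf_diff: "stack_gf s (\<lambda>m. G m - H m) = (\<lambda>m. stack_gf s G m - stack_gf s H m)"
  by (simp add: stack_gf_def sum_subtractf case_prod_beta fun_eq_iff)

lemma bij_betw_map_PiE:
  assumes "distinct ds"
  shows "bij_betw (\<lambda>f. map f ds) (set ds \<rightarrow>\<^sub>E V) {l. length l = length ds \<and> set l \<subseteq> V}"
proof (rule bij_betw_imageI)
  show "inj_on (\<lambda>f. map f ds) (set ds \<rightarrow>\<^sub>E V)"
    by (intro inj_onI) (metis PiE_ext map_eq_conv)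
  show "(\<lambda>f. map f ds) ` (set ds \<rightarrow>\<^sub>E V) = {l. length l = length ds \<and> set l \<subseteq> V}"
  proof (intro equalityI subsetI)
    fix l assume l: "l \<in> {l. length l = length ds \<and> set l \<subseteq> V}"
    define h where "h = restrict (the \<circ> map_of (zip ds l)) (set ds)"
    have "map h ds = l"
      using l assms by (intro nth_equalityI) (auto simp: h_def map_of_zip_nth)
    moreover have "h \<in> set ds \<rightarrow>\<^sub>E V"
    proof
      fix x assume "x \<in> set ds"
      then have "h x \<in> set (map h ds)" by simp
      then show "h x \<in> V" using \<open>map h ds = l\<close> l by auto
    qed (simp add: h_def)
    ultimately show "l \<in> (\<lambda>f. map f ds) ` (set ds \<rightarrow>\<^sub>E V)" by blast
  qed auto
qed

text \<open>The right side depends on \<open>ds\<close> only through its length, so antichains of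
  equal size on different labels have the same series.\<close>

lemma gf_unconstrained:
  assumes "distinct ds"
  shows "gf (set ds) (\<lambda>_. True) m =
    int (card {l. length l = length ds \<and> set l \<subseteq> {1..} \<and> mset l = m})"
proof -
  note b = bij_betw_map_PiE[OF assms, of "{1::nat..}"]
  have "bij_betw (\<lambda>f. map f ds) {f \<in> set ds \<rightarrow>\<^sub>E {1..}. image_mset f (mset_set (set ds)) = m}
      {l. length l = length ds \<and> set l \<subseteq> {1..} \<and> mset l = m}"
  proof (rule bij_betw_subset[OF b, THEN bij_betw_cong[THEN iffD1, rotated]])
    have "(\<lambda>f. map f ds) ` {f \<in> set ds \<rightarrow>\<^sub>E {1..}. image_mset f (mset_set (set ds)) = m} =
      {l \<in> (\<lambda>f. map f ds) ` (set ds \<rightarrow>\<^sub>E {1..}). mset l = m}"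
      using assms by (auto simp: mset_set_set)
    then show "(\<lambda>f. map f ds) ` {f \<in> set ds \<rightarrow>\<^sub>E {1..}. image_mset f (mset_set (set ds)) = m} =
      {l. length l = length ds \<and> set l \<subseteq> {1..} \<and> mset l = m}"
      using b by (auto simp: bij_betw_def)
  qed auto
  then show ?thesis by (simp add: gf_def bij_betw_same_card)
qed

text \<open>A map on \<open>A\<close> amounts to its value at \<open>u\<close>, its list of values
  on \<open>D\<close> and its restriction to \<open>B\<close>; the condition links these parts only
  through the value at \<open>u\<close>. The result sees \<open>D\<close> only through its
  cardinality, so it serves Q posets and pieces of R alike.\<close>

lemma gf_stack:
  assumes fin: "finite B" "finite D" and disj: "u \<notin> B" "u \<notin> D" "B \<inter> D = {}"
    and A: "A = insert u (B \<union> D)"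
    and C: "\<And>f. f \<in> A \<rightarrow>\<^sub>E {1..} \<Longrightarrow>
      C f \<longleftrightarrow> C' (restrict f B) \<and> (\<forall>b\<in>B. f b \<le> f u) \<and> (\<forall>d\<in>D. f u < f d)"
  shows "gf A C m = stack_gf (card D) (gf B C') m"
proof -
  define ds where "ds = sorted_list_of_set D"
  have ds: "set ds = D" "distinct ds" "length ds = card D"
    using fin by (auto simp: ds_def)
  define F where "F = {f \<in> A \<rightarrow>\<^sub>E {1..}. C f \<and> image_mset f (mset_set A) = m}"
  define H where "H p = {g \<in> B \<rightarrow>\<^sub>E {1..}. C' g \<and>
    image_mset g (mset_set B) = m - add_mset (fst p) (mset (snd p))}" for p :: "nat \<times> nat list"
  have content: "image_mset f (mset_set A) =
      image_mset f (mset_set B) + add_mset (f u) (mset (map f ds))" for f :: "nat \<Rightarrow> nat"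
    using fin disj ds unfolding A
    by (simp add: mset_set_Union mset_set_set[symmetric])
  have cong: "image_mset (restrict f B) (mset_set B) = image_mset f (mset_set B)" for f :: "nat \<Rightarrow> nat"
    using fin by (intro image_mset_cong) simp
  have "bij_betw (\<lambda>f. ((f u, map f ds), restrict f B)) F (Sigma (stack_splits (card D) m) H)"
  proof (rule bij_betw_imageI)
    show "inj_on (\<lambda>f. ((f u, map f ds), restrict f B)) F"
    proof (rule inj_onI)
      fix f g assume fg: "f \<in> F" "g \<in> F"
        and eq: "((f u, map f ds), restrict f B) = ((g u, map g ds), restrict g B)"
      have "f x = g x" if "x \<in> A" for x
        using that eq ds(1) unfolding A by (auto dest: fun_cong[of _ _ x])
      then show "f = g" using fg unfolding F_def by (blast intro: PiE_ext)
    qed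
    show "(\<lambda>f. ((f u, map f ds), restrict f B)) ` F = Sigma (stack_splits (card D) m) H"
    proof (intro equalityI subsetI)
      fix q assume "q \<in> (\<lambda>f. ((f u, map f ds), restrict f B)) ` F"
      then obtain f where f: "f \<in> F" "q = ((f u, map f ds), restrict f B)" by auto
      have fA: "f \<in> A \<rightarrow>\<^sub>E {1..}" and "C f" and m: "m = image_mset f (mset_set A)"
        using f by (auto simp: F_def)
      with C[OF fA] have *: "C' (restrict f B)" "\<forall>b\<in>B. f b \<le> f u" "\<forall>d\<in>D. f u < f d"
        by auto
      have d: "m - add_mset (f u) (mset (map f ds)) = image_mset f (mset_set B)"
        unfolding m content by simp
      have "add_mset (f u) (mset (map f ds)) \<subseteq># m"
        unfolding m content by simp
      moreover have "1 \<le> f u" using fA A by auto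
      ultimately have "(f u, map f ds) \<in> stack_splits (card D) m"
        using * ds fin unfolding stack_splits_def mem_Collect_eq prod.case d by simp
      moreover have "restrict f B \<in> H (f u, map f ds)"
        using * fA A by (auto simp: H_def d[simplified] cong)
      ultimately show "q \<in> Sigma (stack_splits (card D) m) H" using f by simp
    next
      fix q assume "q \<in> Sigma (stack_splits (card D) m) H"
      then obtain x l g where q: "q = ((x, l), g)" "(x, l) \<in> stack_splits (card D) m" "g \<in> H (x, l)"
        by auto
      have xl: "1 \<le> x" "length l = card D" "add_mset x (mset l) \<subseteq># m"
        "\<forall>y\<in>#m - add_mset x (mset l). y \<le> x" "\<forall>y\<in>set l. x < y"
        using q by (auto simp: stack_splits_def)
      have g: "g \<in> B \<rightarrow>\<^sub>E {1..}" "C' g" "image_mset g (mset_set B) = m - add_mset x (mset l)"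
        using q by (auto simp: H_def)
      have "l \<in> (\<lambda>f. map f ds) ` (D \<rightarrow>\<^sub>E {1..})"
        using bij_betw_map_PiE[OF ds(2), of "{1::nat..}"] xl ds by (auto simp: bij_betw_def)
      then obtain h where h: "h \<in> D \<rightarrow>\<^sub>E {1..}" "map h ds = l" by auto
      \<comment> \<open>Outside \<open>A\<close> the last branch is \<open>undefined\<close>,
        inherited from the extensional \<open>h\<close>; this puts \<open>f\<close> in the function
        space over \<open>A\<close>.\<close>
      define f where "f i = (if i \<in> B then g i else if i = u then x else h i)" for i
      have fB: "restrict f B = g" and fu: "f u = x"
        using g disj by (auto simp: f_def fun_eq_iff PiE_def extensional_def)
      have fh: "\<forall>d\<in>D. f d = h d" using disj by (auto simp: f_def)
      have fl: "map f ds = l" using h fh ds by auto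
      have fA: "f \<in> A \<rightarrow>\<^sub>E {1..}"
        using g h xl unfolding A by (auto simp: f_def PiE_def extensional_def Pi_def)
      have fm: "image_mset f (mset_set A) = m"
        using g(3) xl(3) unfolding content fu fl cong[of f, unfolded fB, symmetric]
        by (simp only: subset_mset.diff_add)
      have "\<forall>b\<in>B. f b \<le> f u"
      proof
        fix b assume b: "b \<in> B"
        then have "g b \<in># image_mset g (mset_set B)" using fin by auto
        then show "f b \<le> f u" using xl(4) b unfolding g(3) fu by (auto simp: f_def)
      qed
      moreover have "\<forall>d\<in>D. f u < f d" using xl(5) fl ds fu by auto
      ultimately have "f \<in> F" using fA fm C[OF fA] g(2) fB by (simp add: F_def)
      then show "q \<in> (\<lambda>f. ((f u, map f ds), restrict f B)) ` F"
        using q fB fu fl by (auto intro: image_eqI[of _ _ f])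
    qed
  qed
  then have "card F = card (Sigma (stack_splits (card D) m) H)"
    by (rule bij_betw_same_card)
  also have "\<dots> = (\<Sum>p\<in>stack_splits (card D) m. card (H p))"
  proof (intro card_SigmaI ballI finite_stack_splits)
    fix p
    show "finite (H p)"
      by (rule finite_subset[OF _ finite_PiE[OF fin(1), of "\<lambda>_. set_mset m"]])
        (use fin in \<open>auto simp: H_def PiE_iff extensional_def dest!: arg_cong[of "image_mset _ _" _ set_mset] in_diffD\<close>)
  qed
  finally show ?thesis
    unfolding gf_def F_def[symmetric] stack_gf_def case_prod_beta H_def by simp
qed

lemma gf_partition:
  assumes "finite A" "finite I" and "\<And>f. f \<in> A \<rightarrow>\<^sub>E {1..} \<Longrightarrow> C f \<Longrightarrow> \<phi> f \<in> I"
  shows "gf A C m = (\<Sum>i\<in>I. gf A (\<lambda>f. C f \<and> \<phi> f = i) m)"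
proof -
  let ?F = "{f \<in> A \<rightarrow>\<^sub>E {1..}. C f \<and> image_mset f (mset_set A) = m}"
  have "finite ?F"
    by (rule finite_subset[OF _ finite_PiE[OF assms(1), of "\<lambda>_. set_mset m"]])
      (use assms(1) in \<open>auto simp: PiE_iff extensional_def\<close>)
  then have "(\<Sum>i\<in>I. \<Sum>f\<in>{f \<in> ?F. \<phi> f = i}. 1) = (\<Sum>f\<in>?F. 1 :: int)"
    using assms by (intro sum.group) auto
  moreover have "{f \<in> ?F. \<phi> f = i} =
      {f \<in> A \<rightarrow>\<^sub>E {1..}. (C f \<and> \<phi> f = i) \<and> image_mset f (mset_set A) = m}" for i
    by auto
  ultimately show ?thesis by (simp add: gf_def)
qed

section \<open>P-partitions of Q for words ending in 10^s\<close>

definition compatible :: "lposet \<Rightarrow> (nat \<Rightarrow> nat) \<Rightarrow> bool" where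
  "compatible P f \<longleftrightarrow> (\<forall>(i, j)\<in>snd P. f i \<le> f j \<and> (j < i \<longrightarrow> f i < f j))"

lemma P_gf_eq_gf:
  assumes "labelled_poset A P"
  shows "P_gf P = gf A (compatible P)"
proof -
  have P: "fst P = A" "snd P \<subseteq> A \<times> A" using assms by (auto simp: labelled_poset_def)
  have "P_partitions P = {f \<in> A \<rightarrow>\<^sub>E {1..}. compatible P f}"
    using P unfolding P_partitions_def compatible_def by (fastforce simp: subset_iff)
  then show ?thesis
    using P by (simp add: fun_eq_iff P_gf_def gf_def)
qed

text \<open>Nothing in \<open>P\<close> lies above the new element \<open>b\<close>, so the closure
  only puts the down-set of \<open>a\<close> below \<open>b\<close>.\<close>

lemma snd_add_above:
  assumes "labelled_poset A P" "b \<notin> A"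
  shows "snd (add_above a b P) = snd P \<union> {(x, b) | x. (x, a) \<in> (snd P)\<^sup>=}"
proof -
  have P: "snd P \<subseteq> A \<times> A" "trans (snd P)"
    using assms(1) by (auto simp: labelled_poset_def)
  have "(insert (a, b) (snd P))\<^sup>+ = snd P \<union> {(x, b) | x. (x, a) \<in> (snd P)\<^sup>=}"
  proof (intro equalityI subrelI)
    fix x y assume "(x, y) \<in> (insert (a, b) (snd P))\<^sup>+"
    then show "(x, y) \<in> snd P \<union> {(x, b) | x. (x, a) \<in> (snd P)\<^sup>=}"
      by (induction rule: trancl_induct) (use P assms(2) in \<open>auto dest: transD\<close>)
  next
    fix x y assume "(x, y) \<in> snd P \<union> {(x, b) | x. (x, a) \<in> (snd P)\<^sup>=}"
    then show "(x, y) \<in> (insert (a, b) (snd P))\<^sup>+"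
      by (auto intro: trancl_into_trancl)
  qed
  then show ?thesis by (simp add: add_above_def)
qed

text \<open>For each appended zero the swap passes the new largest label on to the element of the
  last one. That element ends up with label k+s+1, the trailing zeroes with k+1, ..., k+s.\<close>

lemma snd_Q_poset_block:
  fixes \<tau> defines "k \<equiv> length \<tau>"
  shows "snd (Q_poset (\<tau> @ True # replicate s False)) =
    snd (Q_poset \<tau>) \<union> {1..k} \<times> {Suc (k + s)} \<union> insert (Suc (k + s)) {1..k} \<times> {Suc k..k + s}"
proof (induction s)
  case 0
  show ?case
    using labelled_poset_Q[of \<tau>]
    by (auto simp: Q_poset_snoc_True ordinal_sum_def antichain_poset_def labelled_poset_def k_def)
next
  case (Suc s)
  let ?a = "Suc (k + s)" and ?b = "Suc (Suc (k + s))"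
  let ?\<rho> = "\<tau> @ True # replicate s False" and ?g = "transpose (Suc (k + s)) (Suc (Suc (k + s)))"
  have len: "length ?\<rho> = ?a" by (simp add: k_def)
  have sub: "snd (Q_poset \<tau>) \<subseteq> {1..k} \<times> {1..k}"
    using labelled_poset_Q[of \<tau>] by (auto simp: labelled_poset_def k_def)
  have "Q_poset (\<tau> @ True # replicate (Suc s) False) = relabel ?g (add_above ?a ?b (Q_poset ?\<rho>))"
    using Q_poset_snoc_False[of ?\<rho>] len by (simp add: replicate_append_same[symmetric])
  then have "snd (Q_poset (\<tau> @ True # replicate (Suc s) False)) =
      map_prod ?g ?g ` snd (add_above ?a ?b (Q_poset ?\<rho>))"
    by (simp add: relabel_def)
  also have "snd (add_above ?a ?b (Q_poset ?\<rho>)) =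
      snd (Q_poset ?\<rho>) \<union> {(x, ?b) | x. (x, ?a) \<in> (snd (Q_poset ?\<rho>))\<^sup>=}"
    by (rule snd_add_above[OF labelled_poset_Q]) (simp add: len del: length_append)
  \<comment> \<open>\<open>?a\<close> labels the element of the last one; by the induction
    hypothesis exactly the elements of \<tau> lie below it.\<close>
  also have "{(x, ?b) | x. (x, ?a) \<in> (snd (Q_poset ?\<rho>))\<^sup>=} = insert ?a {1..k} \<times> {?b}"
    unfolding Suc.IH using sub by auto
  also have "map_prod ?g ?g ` (snd (Q_poset ?\<rho>) \<union> insert ?a {1..k} \<times> {?b}) =
      map_prod ?g ?g ` snd (Q_poset \<tau>) \<union> (?g ` {1..k}) \<times> {?g ?a} \<union>
      (?g ` insert ?a {1..k}) \<times> (?g ` {Suc k..k + s}) \<union> (?g ` insert ?a {1..k}) \<times> {?g ?b}"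
    unfolding Suc.IH by (auto simp: image_Un image_iff map_prod_def)
  \<comment> \<open>The transposition fixes every label up to k+s, so only the two topmost labels
    move.\<close>
  also have "map_prod ?g ?g ` snd (Q_poset \<tau>) = id ` snd (Q_poset \<tau>)"
    using sub by (intro image_cong) (auto simp: transpose_def)
  also have "?g ` {1..k} = id ` {1..k}"
    by (intro image_cong) (auto simp: transpose_def)
  also have "?g ` insert ?a {1..k} = insert ?b (id ` {1..k})"
    unfolding image_insert \<open>?g ` {1..k} = id ` {1..k}\<close> by simp
  also have "?g ` {Suc k..k + s} = id ` {Suc k..k + s}"
    by (intro image_cong) (auto simp: transpose_def)
  finally have eq: "snd (Q_poset (\<tau> @ True # replicate (Suc s) False)) =
      snd (Q_poset \<tau>) \<union> {1..k} \<times> {?b} \<union> insert ?b {1..k} \<times> {Suc k..k + s} \<union> insert ?b {1..k} \<times> {?a}"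
    by simp
  have "{Suc k..k + Suc s} = insert ?a {Suc k..k + s}" by auto
  then show ?case
    by (simp only: eq add_Suc_right) blast
qed

text \<open>The element of the last one has the largest label: relations from \<tau> to it go up in
  label and are weak, those from it to the s zeroes go down and are strict.\<close>

lemma P_gf_Q_block:
  "P_gf (Q_poset (\<tau> @ True # replicate s False)) = stack_gf s (P_gf (Q_poset \<tau>))"
proof
  fix m
  let ?k = "length \<tau>"
  let ?u = "Suc (?k + s)"
  have sub: "snd (Q_poset \<tau>) \<subseteq> {1..?k} \<times> {1..?k}"
    using labelled_poset_Q[of \<tau>] by (auto simp: labelled_poset_def)
  have "gf {1..?u} (compatible (Q_poset (\<tau> @ True # replicate s False))) m =
      stack_gf (card {Suc ?k..?k + s}) (gf {1..?k} (compatible (Q_poset \<tau>))) m"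
  proof (rule gf_stack)
    fix f :: "nat \<Rightarrow> nat"
    have "compatible (Q_poset \<tau>) (restrict f {1..?k}) = compatible (Q_poset \<tau>) f"
      using sub by (fastforce simp: compatible_def)
    \<comment> \<open>Inequalities between \<tau> and the zeroes follow by passing through
      \<open>?u\<close>.\<close>
    moreover have "f b \<le> f d" if "\<forall>b\<in>{1..?k}. f b \<le> f ?u" "\<forall>d\<in>{Suc ?k..?k + s}. f ?u < f d"
      "b \<in> {1..?k}" "d \<in> {Suc ?k..?k + s}" for b d
      using that by (meson less_imp_le order_trans)
    ultimately show "compatible (Q_poset (\<tau> @ True # replicate s False)) f \<longleftrightarrow>
        compatible (Q_poset \<tau>) (restrict f {1..?k}) \<and> (\<forall>b\<in>{1..?k}. f b \<le> f ?u) \<and>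
        (\<forall>d\<in>{Suc ?k..?k + s}. f ?u < f d)"
      unfolding compatible_def snd_Q_poset_block by (auto simp: ball_Un less_imp_le)
  qed auto
  then show "P_gf (Q_poset (\<tau> @ True # replicate s False)) m = stack_gf s (P_gf (Q_poset \<tau>)) m"
    using P_gf_eq_gf[OF labelled_poset_Q[of \<tau>]]
      P_gf_eq_gf[OF labelled_poset_Q[of "\<tau> @ True # replicate s False"]] by simp
qed

section \<open>Nonnegative combinations of the series F(Q)\<close>

text \<open>Combinations are built one summand at a time, so closure properties become inductions
  free of coefficients; repeated steps with the same \<tau> produce its multiplicity.\<close>

inductive Q_positive :: "bool list set \<Rightarrow> (nat multiset \<Rightarrow> int) \<Rightarrow> bool" for U where
  zero: "Q_positive U (\<lambda>m. 0)"
| step: "\<tau> \<in> U \<Longrightarrow> Q_positive U G \<Longrightarrow> Q_positive U (\<lambda>m. P_gf (Q_poset \<tau>) m + G m)"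

lemma Q_positive_add:
  assumes "Q_positive U G" "Q_positive U H"
  shows "Q_positive U (\<lambda>m. G m + H m)"
  using assms(1)
proof induction
  case (step \<tau> G)
  from Q_positive.step[OF step(1,3)] show ?case by (simp add: add.assoc)
qed (use assms(2) in simp)

lemma Q_positive_sum:
  assumes "finite I" "\<And>i. i \<in> I \<Longrightarrow> Q_positive U (G i)"
  shows "Q_positive U (\<lambda>m. \<Sum>i\<in>I. G i m)"
  using assms by (induction I) (auto intro: Q_positive.zero Q_positive_add)

text \<open>Stacking is linear and by \<open>P_gf_Q_block\<close> turns the series of \<tau> into
  that of \<tau> followed by 10^s, so positivity survives.\<close>

lemma Q_positive_stack_gf:
  assumes "Q_positive U G" "\<And>\<tau>. \<tau> \<in> U \<Longrightarrow> \<tau> @ True # replicate s False \<in> V"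
  shows "Q_positive V (stack_gf s G)"
  using assms(1)
proof induction
  case zero
  then show ?case by (simp add: stack_gf_zero Q_positive.zero)
next
  case (step \<tau> G)
  from Q_positive.step[OF assms(2)[OF step(1)] step(3)] show ?case
    by (simp add: stack_gf_add P_gf_Q_block)
qed

lemma Q_positive_coefficients:
  assumes "Q_positive U G" "finite U"
  shows "\<exists>c :: bool list \<Rightarrow> nat. \<forall>m. G m = (\<Sum>\<tau>\<in>U. int (c \<tau>) * P_gf (Q_poset \<tau>) m)"
  using assms(1)
proof induction
  case zero
  show ?case by (intro exI[of _ "\<lambda>_. 0"]) simp
next
  case (step \<tau> G)
  then obtain c :: "bool list \<Rightarrow> nat"
    where c: "\<forall>m. G m = (\<Sum>\<tau>\<in>U. int (c \<tau>) * P_gf (Q_poset \<tau>) m)" by blast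
  have "P_gf (Q_poset \<tau>) m + G m = (\<Sum>\<rho>\<in>U. int ((c(\<tau> := Suc (c \<tau>))) \<rho>) * P_gf (Q_poset \<rho>) m)" for m
    using assms(2) step(1) c by (simp add: sum.remove[of U \<tau>] algebra_simps)
  then show ?case by blast
qed

section \<open>Lexicographic comparison of words\<close>

lemma lex_less_trans: "lex_less a b \<Longrightarrow> lex_less b c \<Longrightarrow> lex_less a c"
  unfolding lex_less_def by (rule lexord_trans) (auto intro: transI)

lemma lex_le_less_trans: "a = b \<or> lex_less a b \<Longrightarrow> lex_less b c \<Longrightarrow> lex_less a c"
  by (auto intro: lex_less_trans)

lemma lex_less_le_trans: "lex_less a b \<Longrightarrow> b = c \<or> lex_less b c \<Longrightarrow> lex_less a c"
  by (auto intro: lex_less_trans)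

lemma lex_less_prefix: "lex_less a b \<Longrightarrow> lex_less (p @ a) (p @ b)"
  unfolding lex_less_def by (rule lexord_append_leftI)

lemma lex_less_suffix: "lex_less a b \<Longrightarrow> length a = length b \<Longrightarrow> lex_less (a @ p) (b @ q)"
  unfolding lex_less_def by (rule lexord_sufI) simp_all

text \<open>Both words agree along the leading ones of \<open>w\<close>; at the next letter 0 stands
  against 1.\<close>

lemma lex_less_snoc_False: "lex_less (w @ [False]) (True # w)"
  unfolding lex_less_def by (induction w) auto

text \<open>Each letter taken out is a one and comes back as a final zero, which lowers the word by
  \<open>lex_less_snoc_False\<close>. In the application \<open>v\<close> is the last one with the
  trailing zeroes.\<close>

lemma lex_less_delete_ones:
  fixes s :: "'a \<Rightarrow> bool" and v :: "bool list"
  assumes "\<forall>x\<in>set L. x \<in> S \<longrightarrow> s x"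
  defines "w \<equiv> map s (filter (\<lambda>x. x \<notin> S) L) @ v @ replicate (length (filter (\<lambda>x. x \<in> S) L)) False"
  shows "w = map s L @ v \<or> lex_less w (map s L @ v)"
    and "set L \<inter> S \<noteq> {} \<Longrightarrow> lex_less w (map s L @ v)"
proof -
  have "(w = map s L @ v \<or> lex_less w (map s L @ v)) \<and> (set L \<inter> S \<noteq> {} \<longrightarrow> lex_less w (map s L @ v))"
    unfolding w_def using assms(1)
  proof (induction L)
    case (Cons x L)
    let ?w = "map s (filter (\<lambda>x. x \<notin> S) L) @ v @ replicate (length (filter (\<lambda>x. x \<in> S) L)) False"
    have IH: "?w = map s L @ v \<or> lex_less ?w (map s L @ v)"
      "set L \<inter> S \<noteq> {} \<longrightarrow> lex_less ?w (map s L @ v)"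
      using Cons by auto
    show ?case
    proof (cases "x \<in> S")
      case True
      \<comment> \<open>Equal lengths allow a zero to be appended to both sides of the
        comparison.\<close>
      have len: "length ?w = length (map s L @ v)"
        using sum_length_filter_compl[of "\<lambda>x. x \<in> S" L] by simp
      have "?w @ [False] = (map s L @ v) @ [False] \<or> lex_less (?w @ [False]) ((map s L @ v) @ [False])"
        using IH(1) lex_less_suffix[OF _ len] by auto
      then have "lex_less (?w @ [False]) (True # map s L @ v)"
        by (rule lex_le_less_trans[OF _ lex_less_snoc_False])
      then show ?thesis
        using True Cons.prems by (simp add: replicate_append_same)
    next
      case False
      then show ?thesis
        using IH lex_less_prefix[of ?w "map s L @ v" "[s x]"] by auto
    qed
  qed simp
  then show "w = map s L @ v \<or> lex_less w (map s L @ v)"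
    "set L \<inter> S \<noteq> {} \<Longrightarrow> lex_less w (map s L @ v)" by auto
qed

section \<open>Splitting the P-partitions of R at the last one\<close>

text \<open>The order is read off from positions in a list of labels, so sublists describe R for the
  shortened words. All relations of R go up in label, hence every inequality is weak.\<close>

definition R_cond :: "(nat \<Rightarrow> bool) \<Rightarrow> nat list \<Rightarrow> (nat \<Rightarrow> nat) \<Rightarrow> bool" where
  "R_cond s L f \<longleftrightarrow> sorted_wrt (\<lambda>i j. \<not> s i \<and> s j \<longrightarrow> f i \<le> f j) L"

text \<open>Here \<open>u\<close> is the last one of the string, and \<open>S\<close> is the set of elements with value above
  \<open>f u\<close>: it cannot contain a zero preceding \<open>u\<close>, and apart from that it is arbitrary.\<close>

lemma gf_R_split:
  assumes dist: "distinct (L1 @ u # L2)" and s: "s u" "\<forall>z\<in>set L2. \<not> s z"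
  defines "K \<equiv> \<lambda>S. filter (\<lambda>x. x \<notin> S) (L1 @ L2)"
  shows "gf (set (L1 @ u # L2)) (R_cond s (L1 @ u # L2)) m =
    (\<Sum>S\<in>Pow ({x \<in> set L1. s x} \<union> set L2). stack_gf (card S) (gf (set (K S)) (R_cond s (K S))) m)"
proof -
  let ?L = "L1 @ u # L2" and ?free = "{x \<in> set L1. s x} \<union> set L2"
  define above where "above f = {x \<in> set ?L. f u < f x}" for f :: "nat \<Rightarrow> nat"
  \<comment> \<open>Being a one, \<open>u\<close> is only an upper end of relations, and the zeroes
    before it are those of \<open>L1\<close>.\<close>
  have R: "R_cond s ?L f \<longleftrightarrow> R_cond s (L1 @ L2) f \<and> (\<forall>z\<in>set L1. \<not> s z \<longrightarrow> f z \<le> f u)" for f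
    using s by (auto simp: R_cond_def sorted_wrt_append)
  have "gf (set ?L) (R_cond s ?L) m =
      (\<Sum>S\<in>Pow ?free. gf (set ?L) (\<lambda>f. R_cond s ?L f \<and> above f = S) m)"
    by (rule gf_partition) (auto simp: R above_def)
  also have "\<dots> = (\<Sum>S\<in>Pow ?free. stack_gf (card S) (gf (set (K S)) (R_cond s (K S))) m)"
  proof (rule sum.cong[OF refl])
    fix S assume "S \<in> Pow ?free"
    then have S: "S \<subseteq> ?free" by simp
    show "gf (set ?L) (\<lambda>f. R_cond s ?L f \<and> above f = S) m =
      stack_gf (card S) (gf (set (K S)) (R_cond s (K S))) m"
    proof (rule gf_stack)
      show "finite S" using S by (rule finite_subset) auto
      show "u \<notin> set (K S)" "u \<notin> S" "set (K S) \<inter> S = {}" "set ?L = insert u (set (K S) \<union> S)"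
        using dist S by (auto simp: K_def)
      fix f :: "nat \<Rightarrow> nat"
      have restr: "R_cond s (K S) (restrict f (set (K S))) \<longleftrightarrow> R_cond s (K S) f"
        unfolding R_cond_def by (intro iffI; erule sorted_wrt_mono_rel[rotated]) auto
      have split: "above f = S \<longleftrightarrow> (\<forall>b\<in>set (K S). f b \<le> f u) \<and> (\<forall>d\<in>S. f u < f d)"
        using S by (auto simp: above_def K_def simp flip: not_less)
      have "R_cond s ?L f \<longleftrightarrow> R_cond s (K S) f" if ab: "above f = S"
      proof
        assume "R_cond s ?L f"
        then show "R_cond s (K S) f"
          unfolding R unfolding K_def R_cond_def by (blast intro: sorted_wrt_filter)
      next
        assume K: "R_cond s (K S) f"
        have z: "\<forall>z\<in>set L1. \<not> s z \<longrightarrow> z \<notin> S"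
          using S dist by auto
        then have zu: "\<forall>z\<in>set L1. \<not> s z \<longrightarrow> f z \<le> f u"
          using ab unfolding split K_def by auto
        have "sorted_wrt (\<lambda>i j. \<not> s i \<and> s j \<longrightarrow> f i \<le> f j) (filter (\<lambda>x. x \<notin> S) L1)"
          using K by (simp add: R_cond_def K_def sorted_wrt_append)
        then have "sorted_wrt (\<lambda>i j. \<not> s i \<and> s j \<longrightarrow> f i \<le> f j) L1"
          using z zu
        proof (induction L1)
          case (Cons x L1)
          \<comment> \<open>A relation lost by deleting a one \<open>y\<close> in \<open>S\<close>
            holds anyway, since \<open>f x\<close> is at most \<open>f u\<close>, which is below
            \<open>f y\<close>.\<close>
          have "f x \<le> f y" if "\<not> s x" "y \<in> set L1" "s y" for y
          proof (cases "y \<in> S")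
            case True
            then have "f u < f y" using ab split by blast
            then show ?thesis using Cons.prems(3) that by force
          next
            case False
            then show ?thesis using Cons.prems that by auto
          qed
          then show ?case using Cons by (auto split: if_splits)
        qed simp
        moreover have "sorted_wrt (\<lambda>i j. \<not> s i \<and> s j \<longrightarrow> f i \<le> f j) L2"
          using s by (auto simp: sorted_wrt_iff_nth_less)
        ultimately show "R_cond s ?L f"
          unfolding R using zu s by (auto simp: R_cond_def sorted_wrt_append)
      qed
      then show "(R_cond s ?L f \<and> above f = S) \<longleftrightarrow> R_cond s (K S) (restrict f (set (K S))) \<and>
          (\<forall>b\<in>set (K S). f b \<le> f u) \<and> (\<forall>d\<in>S. f u < f d)"
        using split restr by blast
    qed simp
  qed
  finally show ?thesis .
qed

text \<open>If a trailing zero stays, the reinserted one moves to the right past it. Otherwise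
  \<open>S\<close> contains all trailing zeroes and, differing from their set, also a one of
  \<open>L1\<close>, whose removal lowers the word.\<close>

lemma lex_less_split:
  fixes s :: "'a \<Rightarrow> bool"
  assumes dist: "distinct (L1 @ u # L2)" and s: "s u" "\<forall>z\<in>set L2. \<not> s z"
    and S: "S \<subseteq> {x \<in> set L1. s x} \<union> set L2" "S \<noteq> set L2"
  shows "lex_less (map s (filter (\<lambda>x. x \<notin> S) (L1 @ L2)) @ True # replicate (card S) False)
    (map s (L1 @ u # L2))"
proof -
  \<comment> \<open>Of the trailing zeroes \<open>c\<close> stay and \<open>e\<close> are deleted;
    \<open>d\<close> counts the deleted ones of \<open>L1\<close>.\<close>
  define c d where "c = length (filter (\<lambda>x. x \<notin> S) L2)" and "d = length (filter (\<lambda>x. x \<in> S) L1)"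
  define e where "e = length (filter (\<lambda>x. x \<in> S) L2)"
  have zeros: "map s M = replicate (length M) False" if "set M \<subseteq> set L2" for M
    using that s by (intro replicate_eqI) auto
  have len: "length L2 = c + e"
    using sum_length_filter_compl[of "\<lambda>x. x \<in> S" L2] by (simp add: c_def e_def)
  have "S = set (filter (\<lambda>x. x \<in> S) (L1 @ L2))" using S by auto
  then have "card S = card (set (filter (\<lambda>x. x \<in> S) (L1 @ L2)))" by simp
  also have "\<dots> = length (filter (\<lambda>x. x \<in> S) (L1 @ L2))"
    using dist by (intro distinct_card distinct_filter) simp
  finally have card: "card S = e + d" by (simp add: d_def e_def)
  let ?F = "map s (filter (\<lambda>x. x \<notin> S) L1)" and ?b = "True # replicate (length L2) False"
  let ?z = "replicate d False" and ?a = "replicate c False @ True # replicate e False"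
  have W: "map s (filter (\<lambda>x. x \<notin> S) (L1 @ L2)) @ True # replicate (card S) False = ?F @ ?a @ ?z"
    using zeros[of "filter (\<lambda>x. x \<notin> S) L2"] by (auto simp: card c_def replicate_add)
  have \<sigma>: "map s (L1 @ u # L2) = map s L1 @ ?b"
    using zeros[of L2] s by simp
  have "lex_less ?a ?b" if "c > 0"
    using that by (cases c) (auto simp: lex_less_def)
  then have ab: "lex_less (?F @ ?a @ ?z) (?F @ ?b @ ?z)" if "c > 0"
    using that len by (intro lex_less_prefix lex_less_suffix) auto
  have ones: "\<forall>x\<in>set L1. x \<in> S \<longrightarrow> s x" using S dist by auto
  note del = lex_less_delete_ones[OF ones, of ?b, folded d_def]
  show ?thesis
  proof (cases "c > 0")
    case True
    then show ?thesis unfolding W \<sigma> using ab del(1) by (blast intro: lex_less_le_trans)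
  next
    case False
    then have "set L2 \<subseteq> S" by (auto simp: c_def filter_empty_conv)
    then have "set L1 \<inter> S \<noteq> {}" using S by auto
    then show ?thesis unfolding W \<sigma> using del(2) False len by simp
  qed
qed

section \<open>Positivity of the remainder, by induction on the length\<close>

text \<open>Stated for any list of distinct labels with any letters, so that the induction
  hypothesis covers the sublists \<open>K S\<close>.\<close>

lemma R_Q_positive:
  fixes s :: "nat \<Rightarrow> bool"
  assumes "distinct L"
  shows "Q_positive {\<tau>. length \<tau> = length L \<and> lex_less \<tau> (map s L)}
    (\<lambda>m. gf (set L) (R_cond s L) m - P_gf (Q_poset (map s L)) m)"
  using assms
proof (induction L rule: length_induct)
  case (1 L)
  show ?case
  proof (cases "\<exists>u\<in>set L. s u")
    case False
    then have w: "map s L = replicate (length L) False"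
      by (intro replicate_eqI) auto
    \<comment> \<open>Without ones both posets are antichains of the same size, compared by
      \<open>gf_unconstrained\<close>.\<close>
    have "R_cond s L = (\<lambda>_. True)"
      using False by (auto simp: R_cond_def fun_eq_iff sorted_wrt_iff_nth_less)
    moreover have "P_gf (Q_poset (map s L)) = gf (set [1..<Suc (length L)]) (\<lambda>_. True)"
      using P_gf_eq_gf[OF labelled_poset_Q, of "map s L"]
      unfolding w Q_poset_zeroes
      by (simp add: antichain_poset_def compatible_def[abs_def] atLeastLessThanSuc_atLeastAtMost del: upt_Suc)
    ultimately have "gf (set L) (R_cond s L) m = P_gf (Q_poset (map s L)) m" for m
      using 1 by (simp only: gf_unconstrained distinct_upt length_upt diff_Suc_1)
    then show ?thesis by (simp add: Q_positive.zero)
  next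
    case True
    then obtain L1 u L2 where L: "L = L1 @ u # L2" and s: "s u" "\<forall>z\<in>set L2. \<not> s z"
      using split_list_last_prop[of L s] by blast
    have dist: "distinct (L1 @ u # L2)" using 1 L by simp
    define K where "K S = filter (\<lambda>x. x \<notin> S) (L1 @ L2)" for S
    define \<F> where "\<F> = Pow ({x \<in> set L1. s x} \<union> set L2)"
    define U where "U = {\<tau>. length \<tau> = length L \<and> lex_less \<tau> (map s L)}"
    define G where "G S = stack_gf (card S) (gf (set (K S)) (R_cond s (K S)))" for S
    define word where "word S = map s (K S) @ True # replicate (card S) False" for S
    have lenK: "length (K S) + Suc (card S) = length L" if "S \<in> \<F>" for S
    proof -
      have "S = set (filter (\<lambda>x. x \<in> S) (L1 @ L2))" using that by (auto simp: \<F>_def)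
      then have "card S = card (set (filter (\<lambda>x. x \<in> S) (L1 @ L2)))" by simp
      also have "\<dots> = length (filter (\<lambda>x. x \<in> S) (L1 @ L2))"
        using dist by (intro distinct_card distinct_filter) simp
      finally show ?thesis
        using sum_length_filter_compl[of "\<lambda>x. x \<in> S" "L1 @ L2"] by (simp add: K_def L)
    qed
    have less: "lex_less (word S) (map s L)" if "S \<in> \<F>" "S \<noteq> set L2" for S
      using lex_less_split[OF dist s] that by (simp add: word_def K_def \<F>_def L)
    \<comment> \<open>Deleting exactly the trailing zeroes and restoring them gives back the word:
      this summand supplies the leading term.\<close>
    have "filter (\<lambda>x. x \<notin> set L2) L1 = L1" using dist by (auto simp: filter_id_conv)
    moreover have "map s L2 = replicate (length L2) False"
      using s by (intro replicate_eqI) auto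
    ultimately have top: "word (set L2) = map s L"
      using dist s by (simp add: word_def K_def L distinct_card)
    have pos: "Q_positive U (\<lambda>m. G S m - P_gf (Q_poset (word S)) m)" if S: "S \<in> \<F>" for S
    proof -
      have "distinct (K S)" using dist by (auto simp: K_def)
      then have "Q_positive {\<tau>. length \<tau> = length (K S) \<and> lex_less \<tau> (map s (K S))}
          (\<lambda>m. gf (set (K S)) (R_cond s (K S)) m - P_gf (Q_poset (map s (K S))) m)"
        using 1(1) lenK[OF S] by simp
      then have "Q_positive U (stack_gf (card S)
          (\<lambda>m. gf (set (K S)) (R_cond s (K S)) m - P_gf (Q_poset (map s (K S))) m))"
      proof (rule Q_positive_stack_gf)
        fix \<tau> assume \<tau>: "\<tau> \<in> {\<tau>. length \<tau> = length (K S) \<and> lex_less \<tau> (map s (K S))}"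
        then have "lex_less (\<tau> @ True # replicate (card S) False) (word S)"
          unfolding word_def by (intro lex_less_suffix) auto
        \<comment> \<open>\<open>word S\<close> equals \<open>map s L\<close> for
          \<open>S = set L2\<close> and lies below it otherwise.\<close>
        then have "lex_less (\<tau> @ True # replicate (card S) False) (map s L)"
          using less[OF S] top lex_less_trans by metis
        then show "\<tau> @ True # replicate (card S) False \<in> U"
          using \<tau> lenK[OF S] by (simp add: U_def)
      qed
      then show ?thesis
        unfolding stack_gf_diff G_def word_def P_gf_Q_block .
    qed
    \<comment> \<open>For these \<open>S\<close> the leading word itself lies in \<open>U\<close>,
      so its series may be added back.\<close>
    have posG: "Q_positive U (G S)" if S: "S \<in> \<F> - {set L2}" for S
    proof -
      have "word S \<in> U" using less[of S] lenK[of S] S by (simp add: U_def word_def)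
      from Q_positive.step[OF this pos[of S]] show ?thesis using S by simp
    qed
    have fin: "finite \<F>" and mem: "set L2 \<in> \<F>" by (auto simp: \<F>_def)
    have "gf (set L) (R_cond s L) m = (\<Sum>S\<in>\<F>. G S m)" for m
      using gf_R_split[OF dist s] by (simp add: L \<F>_def G_def K_def)
    then have "gf (set L) (R_cond s L) m - P_gf (Q_poset (map s L)) m =
        (G (set L2) m - P_gf (Q_poset (word (set L2))) m) + (\<Sum>S\<in>\<F> - {set L2}. G S m)" for m
      using fin mem by (simp add: top sum.remove)
    moreover have "Q_positive U (\<lambda>m. (G (set L2) m - P_gf (Q_poset (word (set L2))) m) +
        (\<Sum>S\<in>\<F> - {set L2}. G S m))"
      using fin mem by (intro Q_positive_add Q_positive_sum pos posG) auto
    ultimately show ?thesis by (simp add: U_def)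
  qed
qed

section \<open>Translation of R and the final expansion\<close>

lemma P_gf_R_poset:
  "P_gf (R_poset \<sigma>) =
    gf (set [1..<Suc (length \<sigma>)]) (R_cond (\<lambda>i. \<sigma> ! (i - 1)) [1..<Suc (length \<sigma>)])"
proof -
  have "compatible (R_poset \<sigma>) f \<longleftrightarrow> R_cond (\<lambda>i. \<sigma> ! (i - 1)) [1..<Suc (length \<sigma>)] f" for f
  proof
    assume "compatible (R_poset \<sigma>) f"
    then show "R_cond (\<lambda>i. \<sigma> ! (i - 1)) [1..<Suc (length \<sigma>)] f"
      by (auto simp: compatible_def R_poset_def R_cond_def sorted_wrt_iff_nth_less simp del: upt_Suc)
  next
    assume R: "R_cond (\<lambda>i. \<sigma> ! (i - 1)) [1..<Suc (length \<sigma>)] f"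
    have "f i \<le> f j" if ij: "1 \<le> i" "i < j" "j \<le> length \<sigma>" "\<not> \<sigma> ! (i - 1)" "\<sigma> ! (j - 1)" for i j
    proof -
      \<comment> \<open>Position i-1 of the list holds the label i.\<close>
      have "i - 1 < j - 1" "j - 1 < length [1..<Suc (length \<sigma>)]" using ij by auto
      from R[unfolded R_cond_def sorted_wrt_iff_nth_less, rule_format, OF this] show ?thesis
        using ij by (simp del: upt_Suc)
    qed
    then show "compatible (R_poset \<sigma>) f"
      by (auto simp: compatible_def R_poset_def)
  qed
  then show ?thesis
    using P_gf_eq_gf[OF labelled_poset_R[of \<sigma>]]
    by (simp add: fun_eq_iff gf_def atLeastLessThanSuc_atLeastAtMost del: upt_Suc)
qed

theorem theorem10p15:
  fixes n :: nat and \<sigma> :: "bool list"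
  assumes "\<sigma> \<in> zero_strings n"
  shows "\<exists>c :: bool list \<Rightarrow> nat. \<forall>m.
    P_gf (R_poset \<sigma>) m = P_gf (Q_poset \<sigma>) m +
      (\<Sum>\<tau> \<in> {\<tau> \<in> zero_strings n. lex_less \<tau> \<sigma>}. int (c \<tau>) * P_gf (Q_poset \<tau>) m)"
proof -
  let ?s = "\<lambda>i. \<sigma> ! (i - 1)" and ?L = "[1..<Suc (length \<sigma>)]"
  have n: "length \<sigma> = n" "\<sigma> \<noteq> []" "\<not> hd \<sigma>" using assms by (auto simp: zero_strings_def)
  have w: "map ?s ?L = \<sigma>" by (intro nth_equalityI) (simp_all del: upt_Suc)
  have "{\<tau>. length \<tau> = n \<and> lex_less \<tau> \<sigma>} = {\<tau> \<in> zero_strings n. lex_less \<tau> \<sigma>}"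
  proof -
    \<comment> \<open>A word of length n below one that begins with 0 must begin with 0 too.\<close>
    have "\<tau> \<in> zero_strings n" if "length \<tau> = n" "lex_less \<tau> \<sigma>" for \<tau>
      using that n by (cases \<tau>; cases \<sigma>) (auto simp: zero_strings_def lex_less_def)
    then show ?thesis by (auto simp: zero_strings_def)
  qed
  then have "Q_positive {\<tau> \<in> zero_strings n. lex_less \<tau> \<sigma>}
      (\<lambda>m. P_gf (R_poset \<sigma>) m - P_gf (Q_poset \<sigma>) m)"
    using R_Q_positive[of ?L ?s] n(1) unfolding w P_gf_R_poset by (simp del: upt_Suc)
  moreover have "finite {\<tau> \<in> zero_strings n. lex_less \<tau> \<sigma>}"
    by (rule finite_subset[OF _ finite_lists_length_eq[of "UNIV :: bool set" n]])
      (auto simp: zero_strings_def)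
  ultimately obtain c :: "bool list \<Rightarrow> nat" where
    "\<forall>m. P_gf (R_poset \<sigma>) m - P_gf (Q_poset \<sigma>) m =
      (\<Sum>\<tau> \<in> {\<tau> \<in> zero_strings n. lex_less \<tau> \<sigma>}. int (c \<tau>) * P_gf (Q_poset \<tau>) m)"
    using Q_positive_coefficients by blast
  then show ?thesis by (intro exI[of _ c]) (simp add: algebra_simps)
qed

end
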